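(* Let $\alpha,\beta \in \mathbb{R}$. The entrywise power function $\Psi_{\alpha,\beta}$ preserves Loewner positivity on $\mathbb{P}_3(\mathbb{C})$ if and only if $\beta \in \mathbb{Z}$ and $\alpha \geq \max(1,|\beta|)$.
   Context: $\mathbb{P}_3(\mathbb{C})$ denotes the set of $3 \times 3$ complex Hermitian positive semidefinite matrices. For $\alpha,\beta \in \mathbb{R}$, $\Psi_{\alpha,\beta}:\mathbb{C}\to\mathbb{C}$ is defined by $\Psi_{\alpha,\beta}(re^{i\theta}) := r^\alpha e^{i\beta\theta}$ for $r>0$, $\theta \in (-\pi,\pi]$, and $\Psi_{\alpha,\beta}(0) := 0$. For a matrix $A = (a_{st})$, $\Psi_{\alpha,\beta}[A] := (\Psi_{\alpha,\beta}(a_{st}))$. "$\Psi_{\alpha,\beta}$ preserves Loewner positivity on $\mathbb{P}_3(\mathbb{C})$" means $\Psi_{\alpha,\beta}[A] \in \mathbb{P}_3(\mathbb{C})$ for all $A \in \mathbb{P}_3(\mathbb{C})$. *)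

theory Defs
  imports "HOL-Analysis.Analysis"
begin

definition hermitian :: "complex ^ 'n ^ 'n \<Rightarrow> bool" where
  "hermitian A \<longleftrightarrow> map_matrix cnj (transpose A) = A"

text \<open>The quadratic form $x^* A x$ is a complex number; membership in the set of
  nonnegative reals says that it is real and nonnegative.\<close>

definition psd_matrices :: "(complex ^ 'n ^ 'n) set" where
  "psd_matrices = {A. hermitian A \<and>
     (\<forall>x. (\<Sum>i\<in>UNIV. cnj (x $ i) * (A *v x) $ i) \<in> \<real>\<^sub>\<ge>\<^sub>0)}"

text \<open>\<open>Arg\<close> takes its values in $(-\pi, \pi]$, and \<open>rcis r t\<close> is $r e^{it}$.\<close>

definition Psi :: "real \<Rightarrow> real \<Rightarrow> complex \<Rightarrow> complex" where
  "Psi \<alpha> \<beta> z = (if z = 0 then 0 else rcis (cmod z powr \<alpha>) (\<beta> * Arg z))"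

definition preserves_positivity_on ::
    "(complex \<Rightarrow> complex) \<Rightarrow> (complex ^ 'n ^ 'n) set \<Rightarrow> bool" where
  "preserves_positivity_on f S \<longleftrightarrow> (\<forall>A\<in>S. map_matrix f A \<in> psd_matrices)"

end

theory Submission
  imports Defs
begin

text \<open>
  A Hermitian \<open>3 \<times> 3\<close> matrix with diagonal \<open>k, l, m\<close> and entries \<open>a, b, c\<close> above it is positive
  semidefinite iff its principal minors are nonnegative (\<open>psd_matrices_3_iff\<close>), and its determinant is
  \<open>k l m + 2 Re (a (cnj b) c) - k |c|\<^sup>2 - l |b|\<^sup>2 - m |a|\<^sup>2\<close>. So the theorem is about three moduli and one
  angle, the argument of \<open>a (cnj b) c\<close>.

  Sufficiency. As \<open>Psi \<alpha> \<beta>\<close> is compatible with multiplication by positive numbers, the diagonal may be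
  scaled to \<open>1\<close>. Since \<open>Psi \<alpha> n z = z * Psi (\<alpha> - 1) (n - 1) z\<close> and positivity survives entrywise
  products (\<open>correlation_schur_product\<close>), the case of an integer \<open>\<beta> = n \<ge> 2\<close> reduces to \<open>\<beta> = 1\<close>;
  negative \<open>\<beta>\<close> follows by conjugation. For \<open>\<beta> = 1\<close> the angle is unchanged, and for \<open>\<beta> = 0\<close> it is
  replaced by \<open>0\<close>, which only helps. What remains is a real inequality: for \<open>x, y, z\<close> in \<open>[0, 1]\<close>,
  \<open>\<gamma> \<le> 1\<close> and \<open>\<alpha> \<ge> 1\<close>, the condition \<open>x\<^sup>2 + y\<^sup>2 + z\<^sup>2 \<le> 1 + 2 x y z \<gamma>\<close> passes to the \<open>\<alpha>\<close>-th powers of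
  \<open>x, y, z\<close>, with the same \<open>\<gamma>\<close>. For nonzero \<open>x, y, z\<close>, division by \<open>x y z\<close> turns the condition into
  \<open>h 1 \<ge> 2 (1 - \<gamma>)\<close>, and the condition on the powers into \<open>h \<alpha> \<ge> 2 (1 - \<gamma>)\<close>, where \<open>h t\<close> is a sum of
  exponentials. The function \<open>h\<close> vanishes at \<open>0\<close>, and once it is nonnegative at a positive argument it no
  longer decreases. Hence \<open>h \<alpha> \<ge> h 1\<close> (\<open>exponential_sum_increases\<close>).

  Necessity. One singular matrix gives \<open>\<alpha> \<ge> 1\<close>. A matrix of rank one with unimodular entries whose
  principal arguments add up to \<open>2 \<pi>\<close> around the triangle gives \<open>\<beta> \<in> \<int>\<close>. For \<open>\<alpha> \<ge> \<bar>\<beta>\<bar>\<close>, take the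
  circulant matrices \<open>J + s w w\<^sup>*\<close> with \<open>s > 0\<close>, where \<open>J\<close> is the all-ones matrix and \<open>w\<close> lists the cube
  roots of unity. Their images are again circulant, and two of the eigenvalues of the images are
  \<open>3 s (\<alpha> - \<beta>) / 2\<close> and \<open>3 s (\<alpha> + \<beta>) / 2\<close> to first order in \<open>s\<close>, so neither coefficient can be
  negative (\<open>exponent_ge_angle_factor_of_preserves\<close>).
\<close>

section \<open>Sums of exponentials with one change of sign\<close>

text \<open>
  A function that vanishes at \<open>0\<close> and is nonnegative at some \<open>s > 0\<close> has nonnegative slope somewhere
  in between, by the mean value theorem. If the slope can change sign on the positive axis only from
  negative to positive, it is nonnegative from there on. In particular the function again changes sign
  only in that direction, so the lemma can be applied repeatedly.
\<close>

lemma single_crossing_integrates: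
  fixes f f' :: "real \<Rightarrow> real"
  assumes f0: "f 0 = 0"
    and deriv: "\<And>t. (f has_real_derivative f' t) (at t)"
    and cross: "\<And>u v. 0 < u \<Longrightarrow> u \<le> v \<Longrightarrow> 0 \<le> f' u \<Longrightarrow> 0 \<le> f' v"
    and s: "0 < s" "0 \<le> f s" and t: "s \<le> t"
  shows "f s \<le> f t"
proof -
  obtain \<xi> where \<xi>: "0 < \<xi>" "\<xi> < s" "f s - f 0 = (s - 0) * f' \<xi>"
    using MVT2[of 0 s f f'] s deriv by blast
  have "0 \<le> f' \<xi>"
    using \<xi> s f0 by (simp add: zero_le_mult_iff)
  then have "0 \<le> f' u" if "s \<le> u" for u
    using cross[of \<xi> u] \<xi> that by simp
  then show ?thesis
    using DERIV_nonneg_imp_nondecreasing[of s t f] t deriv by blast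
qed

text \<open>
  The hypothesis allows \<open>p\<close> to be negative, and then \<open>h\<close> may decrease at first. The signs of \<open>h\<close> are
  controlled by differentiating twice. Each derivative is divided by one of its exponentials, so that
  a constant term appears and the next differentiation removes it: \<open>h' = exp (q t) k\<close>,
  \<open>k' = exp ((p - q) t) m\<close>. Both \<open>h\<close> and \<open>k\<close> vanish at \<open>0\<close>, and \<open>m\<close> is nondecreasing, because its two
  exponentials have nonnegative coefficients and rates.
\<close>

lemma exponential_sum_increases:
  fixes p q r t :: real
  defines "h \<equiv> \<lambda>t. exp ((p + q + r) * t) + 2 - exp (p * t) - exp (q * t) - exp (r * t)"
  assumes ord: "p \<le> r" "r \<le> q" "0 \<le> p + r"
    and h1: "0 \<le> h 1" and t: "1 \<le> t"
  shows "h 1 \<le> h t"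
proof -
  define k where "k = (\<lambda>t. (p + q + r) * exp ((p + r) * t) - p * exp ((p - q) * t) - q - r * exp ((r - q) * t))"
  define m where "m = (\<lambda>t. (p + q + r) * (p + r) * exp ((q + r) * t) + p * (q - p)
    + r * (q - r) * exp ((r - p) * t))"
  have m_mono: "m u \<le> m v" if "u \<le> v" for u v
  proof -
    have "0 \<le> (p + q + r) * (p + r)" "0 \<le> r * (q - r)"
      using ord by simp_all
    moreover have "(q + r) * u \<le> (q + r) * v" "(r - p) * u \<le> (r - p) * v"
      using ord that by (simp_all add: mult_left_mono)
    ultimately have "(p + q + r) * (p + r) * exp ((q + r) * u) \<le> (p + q + r) * (p + r) * exp ((q + r) * v)"
      "r * (q - r) * exp ((r - p) * u) \<le> r * (q - r) * exp ((r - p) * v)"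
      by (intro mult_left_mono; simp)+
    then show ?thesis
      unfolding m_def by linarith
  qed
  have k_deriv: "(k has_real_derivative exp ((p - q) * t) * m t) (at t)" for t
    unfolding k_def m_def
    by (rule derivative_eq_intros refl | simp)+
      (simp add: algebra_simps flip: exp_add)
  have h_deriv: "(h has_real_derivative exp (q * t) * k t) (at t)" for t
    unfolding k_def h_def
    by (rule derivative_eq_intros refl | simp)+
      (simp add: algebra_simps flip: exp_add)
  have k_cross: "0 \<le> k v" if "0 < u" "u \<le> v" "0 \<le> k u" for u v
  proof -
    have "k u \<le> k v"
    proof (rule single_crossing_integrates[OF _ k_deriv _ that(1,3,2)])
      show "0 \<le> exp ((p - q) * v) * m v" if "u \<le> v" "0 \<le> exp ((p - q) * u) * m u" for u v
        using m_mono[OF that(1)] that(2) by (simp add: zero_le_mult_iff)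
    qed (simp add: k_def)
    then show ?thesis using that by simp
  qed
  show ?thesis
  proof (rule single_crossing_integrates[OF _ h_deriv _ _ h1 t])
    show "0 \<le> exp (q * v) * k v" if "0 < u" "u \<le> v" "0 \<le> exp (q * u) * k u" for u v
      using k_cross[OF that(1,2)] that(3) by (simp add: zero_le_mult_iff)
  qed (simp_all add: h_def)
qed

section \<open>The determinant inequality for powers of the moduli\<close>

text \<open>
  Dividing the difference of the two sides by the product \<open>x y z\<close> (or by its \<open>\<alpha>\<close>-th power) gives
  \<open>h t - 2 (1 - c)\<close> at \<open>t = 1\<close> (or at \<open>t = \<alpha>\<close>), with \<open>h\<close> the sum of exponentials above. The rates
  are the logarithms of \<open>x / (y z)\<close>, \<open>z / (x y)\<close> and \<open>y / (x z)\<close>, whose sum is that of \<open>1 / (x y z)\<close>.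
\<close>

lemma powers_preserve_cubic_inequality_sorted:
  fixes x y z c \<alpha> :: real
  assumes xyz: "0 < x" "x \<le> y" "y \<le> z" "z \<le> 1" and c: "c \<le> 1" and \<alpha>: "1 \<le> \<alpha>"
    and le: "x\<^sup>2 + y\<^sup>2 + z\<^sup>2 \<le> 1 + 2 * (x * y * z * c)"
  shows "(x powr \<alpha>)\<^sup>2 + (y powr \<alpha>)\<^sup>2 + (z powr \<alpha>)\<^sup>2
    \<le> 1 + 2 * (x powr \<alpha> * y powr \<alpha> * z powr \<alpha> * c)"
proof -
  define p q r where "p = ln x - ln y - ln z" "q = ln z - ln x - ln y" "r = ln y - ln x - ln z"
  define h where "h = (\<lambda>t. exp ((p + q + r) * t) + 2 - exp (p * t) - exp (q * t) - exp (r * t))"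
  have pos: "0 < y" "0 < z" using xyz by auto
  have h_eq: "x powr t * y powr t * z powr t * (h t - 2 * (1 - c))
    = 1 + 2 * (x powr t * y powr t * z powr t * c) - (x powr t)\<^sup>2 - (y powr t)\<^sup>2 - (z powr t)\<^sup>2" for t
    using xyz pos unfolding h_def p_q_r_def powr_def
    by (simp add: algebra_simps power2_eq_square flip: exp_add)
  have "p \<le> r" "r \<le> q" "0 \<le> p + r"
    using xyz pos by (simp_all add: p_q_r_def)
  moreover have h1: "2 * (1 - c) \<le> h 1"
  proof -
    have "0 \<le> x * y * z * (h 1 - 2 * (1 - c))"
      using h_eq[of 1] le xyz pos by simp
    then show ?thesis
      using mult_pos_pos[OF mult_pos_pos[OF xyz(1) pos(1)] pos(2)]
      by (simp only: zero_le_mult_iff) linarith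
  qed
  ultimately have "h 1 \<le> h \<alpha>"
    unfolding h_def using c \<alpha> by (intro exponential_sum_increases) (auto simp: h_def)
  then have "0 \<le> x powr \<alpha> * y powr \<alpha> * z powr \<alpha> * (h \<alpha> - 2 * (1 - c))"
    using h1 by simp
  then show ?thesis
    unfolding h_eq by linarith
qed

text \<open>
  The inequality is symmetric in \<open>x, y, z\<close>. If one of them is \<open>0\<close>, the product vanishes on both sides
  and the squares can only shrink.
\<close>

lemma powers_preserve_cubic_inequality:
  fixes x y z c \<alpha> :: real
  assumes x: "0 \<le> x" "x \<le> 1" and y: "0 \<le> y" "y \<le> 1" and z: "0 \<le> z" "z \<le> 1"
    and c: "c \<le> 1" and \<alpha>: "1 \<le> \<alpha>"
    and le: "x\<^sup>2 + y\<^sup>2 + z\<^sup>2 \<le> 1 + 2 * (x * y * z * c)"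
  shows "(x powr \<alpha>)\<^sup>2 + (y powr \<alpha>)\<^sup>2 + (z powr \<alpha>)\<^sup>2
    \<le> 1 + 2 * (x powr \<alpha> * y powr \<alpha> * z powr \<alpha> * c)"
proof (cases "x = 0 \<or> y = 0 \<or> z = 0")
  case True
  have "(u powr \<alpha>)\<^sup>2 \<le> u\<^sup>2" if "0 \<le> u" "u \<le> 1" for u :: real
  proof -
    have "u powr \<alpha> \<le> u"
      using powr_mono'[of 1 \<alpha> u] that \<alpha> by (cases "u = 0") simp_all
    then show ?thesis
      by (intro power_mono) auto
  qed
  from this[OF x] this[OF y] this[OF z] show ?thesis
    using True le by auto
next
  case False
  then have pos: "0 < x" "0 < y" "0 < z" using x y z by auto
  consider "x \<le> y" "y \<le> z" | "x \<le> z" "z \<le> y" | "y \<le> x" "x \<le> z"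
    | "y \<le> z" "z \<le> x" | "z \<le> x" "x \<le> y" | "z \<le> y" "y \<le> x"
    by linarith
  then show ?thesis
  proof cases
    case 1
    then show ?thesis
      using powers_preserve_cubic_inequality_sorted[of x y z c \<alpha>] pos assms by (simp add: ac_simps)
  next
    case 2
    then show ?thesis
      using powers_preserve_cubic_inequality_sorted[of x z y c \<alpha>] pos assms by (simp add: ac_simps)
  next
    case 3
    then show ?thesis
      using powers_preserve_cubic_inequality_sorted[of y x z c \<alpha>] pos assms by (simp add: ac_simps)
  next
    case 4
    then show ?thesis
      using powers_preserve_cubic_inequality_sorted[of y z x c \<alpha>] pos assms by (simp add: ac_simps)
  next
    case 5
    then show ?thesis
      using powers_preserve_cubic_inequality_sorted[of z x y c \<alpha>] pos assms by (simp add: ac_simps)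
  next
    case 6
    then show ?thesis
      using powers_preserve_cubic_inequality_sorted[of z y x c \<alpha>] pos assms by (simp add: ac_simps)
  qed
qed

section \<open>Positive semidefinite matrices of order three\<close>

text \<open>
  For necessity of the determinant condition, the form is evaluated at a vector in the kernel of one
  row. The value is the determinant times the diagonal entry of that row, which gives no information
  if this entry is \<open>0\<close>; hence both rows are used, and another vector if \<open>m = n = 0\<close>. The converse
  is the inequality between the arithmetic and the geometric mean.
\<close>

lemma binary_form_nonneg_iff:
  fixes m n :: real and w :: complex
  shows "(\<forall>u v. 0 \<le> m * (cmod u)\<^sup>2 + n * (cmod v)\<^sup>2 + 2 * Re (cnj u * w * v))
    \<longleftrightarrow> 0 \<le> m \<and> 0 \<le> n \<and> (cmod w)\<^sup>2 \<le> m * n"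
proof (intro iffI conjI allI)
  assume nonneg: "\<forall>u v. 0 \<le> m * (cmod u)\<^sup>2 + n * (cmod v)\<^sup>2 + 2 * Re (cnj u * w * v)"
  show m: "0 \<le> m" using nonneg[rule_format, of 1 0] by simp
  show n: "0 \<le> n" using nonneg[rule_format, of 0 1] by simp
  have "0 \<le> n * (m * n - (cmod w)\<^sup>2)"
    using nonneg[rule_format, of "of_real n" "- cnj w"]
    by (simp add: cmod_power2) (simp add: algebra_simps power2_eq_square)
  moreover have "0 \<le> m * (m * n - (cmod w)\<^sup>2)"
    using nonneg[rule_format, of "- w" "of_real m"]
    by (simp add: cmod_power2) (simp add: algebra_simps power2_eq_square)
  moreover have "(cmod w)\<^sup>2 \<le> 0" if "m = 0" "n = 0"
    using nonneg[rule_format, of "- w" 1] that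
    by (simp add: cmod_power2) (simp add: algebra_simps power2_eq_square)
  ultimately show "(cmod w)\<^sup>2 \<le> m * n"
    using m n by (cases "m = 0"; cases "n = 0") (auto simp: zero_le_mult_iff mult_le_0_iff)
next
  fix u v
  assume mn: "0 \<le> m \<and> 0 \<le> n \<and> (cmod w)\<^sup>2 \<le> m * n"
  then have w: "cmod w \<le> sqrt m * sqrt n"
    by (metis real_le_rsqrt real_sqrt_mult)
  have "- Re (cnj u * w * v) \<le> cmod (cnj u * w * v)"
    using abs_Re_le_cmod abs_le_D2 by blast
  also have "\<dots> \<le> (sqrt m * cmod u) * (sqrt n * cmod v)"
    using mult_right_mono[OF w, of "cmod u * cmod v"] by (simp add: norm_mult ac_simps)
  also have "2 * \<dots> \<le> m * (cmod u)\<^sup>2 + n * (cmod v)\<^sup>2"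
    using sum_squares_bound[of "sqrt m * cmod u" "sqrt n * cmod v"] mn
    by (simp add: power_mult_distrib ac_simps)
  finally show "0 \<le> m * (cmod u)\<^sup>2 + n * (cmod v)\<^sup>2 + 2 * Re (cnj u * w * v)"
    by simp
qed

text \<open>
  The principal minors of the Hermitian matrix with real diagonal \<open>k, l, m\<close> and with the entries
  \<open>a, b, c\<close> in the positions \<open>(1,2), (1,3), (2,3)\<close>. The case \<open>k = l = m = 1\<close> describes correlation
  matrices.
\<close>

definition minors_nonneg :: "real \<Rightarrow> real \<Rightarrow> real \<Rightarrow> complex \<Rightarrow> complex \<Rightarrow> complex \<Rightarrow> bool" where
  "minors_nonneg k l m a b c \<longleftrightarrow>
     0 \<le> k \<and> 0 \<le> l \<and> 0 \<le> m \<and>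
     (cmod a)\<^sup>2 \<le> k * l \<and> (cmod b)\<^sup>2 \<le> k * m \<and> (cmod c)\<^sup>2 \<le> l * m \<and>
     k * (cmod c)\<^sup>2 + l * (cmod b)\<^sup>2 + m * (cmod a)\<^sup>2 \<le> k * l * m + 2 * Re (a * cnj b * c)"

definition ternary_form ::
    "real \<Rightarrow> real \<Rightarrow> real \<Rightarrow> complex \<Rightarrow> complex \<Rightarrow> complex \<Rightarrow> complex \<Rightarrow> complex \<Rightarrow> complex \<Rightarrow> real" where
  "ternary_form k l m a b c x y z =
     k * (cmod x)\<^sup>2 + l * (cmod y)\<^sup>2 + m * (cmod z)\<^sup>2
     + 2 * Re (cnj x * a * y + cnj x * b * z + cnj y * c * z)"

text \<open>
  The next two identities express the determinant and the quadratic form through the Schur complement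
  of the entry \<open>m\<close>, multiplied by \<open>m\<close> to avoid denominators. They reduce three variables to two.
\<close>

lemma schur_complement_det:
  fixes k l m :: real and a b c :: complex
  shows "m * (k * l * m + 2 * Re (a * cnj b * c) - (k * (cmod c)\<^sup>2 + l * (cmod b)\<^sup>2 + m * (cmod a)\<^sup>2))
    = (k * m - (cmod b)\<^sup>2) * (l * m - (cmod c)\<^sup>2) - (cmod (a * of_real m - b * cnj c))\<^sup>2"
  by (simp add: cmod_power2) (simp add: algebra_simps power2_eq_square)

lemma schur_complement_form:
  "m * ternary_form k l m a b c x y z
    = (cmod (cnj b * x + cnj c * y + of_real m * z))\<^sup>2
      + ((k * m - (cmod b)\<^sup>2) * (cmod x)\<^sup>2 + (l * m - (cmod c)\<^sup>2) * (cmod y)\<^sup>2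
         + 2 * Re (cnj x * (a * of_real m - b * cnj c) * y))"
  by (simp add: ternary_form_def cmod_power2) (simp add: algebra_simps power2_eq_square)

text \<open>
  A zero on the diagonal forces its row to vanish, and with it every term of the determinant.
\<close>

lemma det_nonneg_of_zero_diagonal:
  assumes "(cmod a)\<^sup>2 \<le> k * l" "(cmod b)\<^sup>2 \<le> k * m" "(cmod c)\<^sup>2 \<le> l * m" "k = 0 \<or> l = 0 \<or> m = 0"
  shows "k * (cmod c)\<^sup>2 + l * (cmod b)\<^sup>2 + m * (cmod a)\<^sup>2 \<le> k * l * m + 2 * Re (a * cnj b * c)"
  using assms by auto

lemma ternary_form_nonneg_iff:
  "(\<forall>x y z. 0 \<le> ternary_form k l m a b c x y z) \<longleftrightarrow> minors_nonneg k l m a b c"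
proof
  assume nonneg: "\<forall>x y z. 0 \<le> ternary_form k l m a b c x y z"
  have ab: "0 \<le> k \<and> 0 \<le> l \<and> (cmod a)\<^sup>2 \<le> k * l"
    using nonneg[rule_format, of _ _ 0]
    by (subst binary_form_nonneg_iff[symmetric]) (simp add: ternary_form_def)
  have ac: "0 \<le> k \<and> 0 \<le> m \<and> (cmod b)\<^sup>2 \<le> k * m"
    using nonneg[rule_format, of _ 0 _]
    by (subst binary_form_nonneg_iff[symmetric]) (simp add: ternary_form_def)
  have bc: "0 \<le> l \<and> 0 \<le> m \<and> (cmod c)\<^sup>2 \<le> l * m"
    using nonneg[rule_format, of 0 _ _]
    by (subst binary_form_nonneg_iff[symmetric]) (simp add: ternary_form_def)
  have "k * (cmod c)\<^sup>2 + l * (cmod b)\<^sup>2 + m * (cmod a)\<^sup>2 \<le> k * l * m + 2 * Re (a * cnj b * c)"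
  proof (cases "m = 0")
    case True
    then show ?thesis using ab ac bc det_nonneg_of_zero_diagonal by blast
  next
    case False
    then have m: "0 < m" using ac by simp
    have "0 \<le> (k * m - (cmod b)\<^sup>2) * (cmod x)\<^sup>2 + (l * m - (cmod c)\<^sup>2) * (cmod y)\<^sup>2
         + 2 * Re (cnj x * (a * of_real m - b * cnj c) * y)" for x y
    proof -
      \<comment> \<open>the value that annihilates the square in the Schur complement identity\<close>
      define z where "z = - (cnj b * x + cnj c * y) / of_real m"
      have "cnj b * x + cnj c * y + of_real m * z = 0"
        using m by (simp add: z_def)
      then show ?thesis
        using schur_complement_form[of m k l a b c x y z] nonneg m
        by (metis add_0 less_eq_real_def norm_zero power_zero_numeral zero_le_mult_iff)
    qed
    then have "(cmod (a * of_real m - b * cnj c))\<^sup>2 \<le> (k * m - (cmod b)\<^sup>2) * (l * m - (cmod c)\<^sup>2)"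
      using binary_form_nonneg_iff by blast
    then have "0 \<le> m * (k * l * m + 2 * Re (a * cnj b * c) - (k * (cmod c)\<^sup>2 + l * (cmod b)\<^sup>2 + m * (cmod a)\<^sup>2))"
      unfolding schur_complement_det by simp
    then show ?thesis using m by (simp add: zero_le_mult_iff)
  qed
  then show "minors_nonneg k l m a b c"
    using ab ac bc by (simp add: minors_nonneg_def)
next
  assume min: "minors_nonneg k l m a b c"
  show "\<forall>x y z. 0 \<le> ternary_form k l m a b c x y z"
  proof (intro allI)
    fix x y z
    show "0 \<le> ternary_form k l m a b c x y z"
    proof (cases "m = 0")
      case True
      then have "b = 0" "c = 0" using min by (auto simp: minors_nonneg_def)
      then have "ternary_form k l m a b c x y z = k * (cmod x)\<^sup>2 + l * (cmod y)\<^sup>2 + 2 * Re (cnj x * a * y)"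
        using True by (simp add: ternary_form_def)
      moreover have "0 \<le> k \<and> 0 \<le> l \<and> (cmod a)\<^sup>2 \<le> k * l"
        using min by (simp add: minors_nonneg_def)
      ultimately show ?thesis
        using binary_form_nonneg_iff[of k l a] by simp
    next
      case False
      then have m: "0 < m" using min by (simp add: minors_nonneg_def)
      then have "0 \<le> m * (k * l * m + 2 * Re (a * cnj b * c) - (k * (cmod c)\<^sup>2 + l * (cmod b)\<^sup>2 + m * (cmod a)\<^sup>2))"
        using min by (simp add: minors_nonneg_def)
      then have "(cmod (a * of_real m - b * cnj c))\<^sup>2 \<le> (k * m - (cmod b)\<^sup>2) * (l * m - (cmod c)\<^sup>2)"
        unfolding schur_complement_det by simp
      moreover have "0 \<le> k * m - (cmod b)\<^sup>2" "0 \<le> l * m - (cmod c)\<^sup>2"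
        using min by (simp_all add: minors_nonneg_def)
      ultimately have "0 \<le> (k * m - (cmod b)\<^sup>2) * (cmod x)\<^sup>2 + (l * m - (cmod c)\<^sup>2) * (cmod y)\<^sup>2
         + 2 * Re (cnj x * (a * of_real m - b * cnj c) * y)"
        using binary_form_nonneg_iff by blast
      then have "0 \<le> m * ternary_form k l m a b c x y z"
        unfolding schur_complement_form by simp
      then show ?thesis using m by (simp add: zero_le_mult_iff)
    qed
  qed
qed

lemma hermitian_iff: "hermitian A \<longleftrightarrow> (\<forall>i j. cnj (A $ j $ i) = A $ i $ j)"
  by (simp add: hermitian_def vec_eq_iff map_matrix_def transpose_def)

lemma ternary_form_sesquilinear:
  "of_real (ternary_form k l m a b c x y z) =
    cnj x * (of_real k * x + a * y + b * z) + cnj y * (cnj a * x + of_real l * y + c * z)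
    + cnj z * (cnj b * x + cnj c * y + of_real m * z)"
proof -
  have twice_Re: "of_real (2 * Re w) = w + cnj w" for w
    by (rule complex_add_cnj[symmetric])
  show ?thesis
    unfolding ternary_form_def of_real_add twice_Re
    unfolding of_real_mult complex_norm_square
    by (simp only: complex_cnj_add complex_cnj_mult complex_cnj_cnj algebra_simps)
qed

lemma hermitian_form_3:
  fixes A :: "complex ^ 3 ^ 3"
  assumes "hermitian A"
  shows "(\<Sum>i\<in>UNIV. cnj (x $ i) * (A *v x) $ i) = of_real
    (ternary_form (Re (A $ 1 $ 1)) (Re (A $ 2 $ 2)) (Re (A $ 3 $ 3)) (A $ 1 $ 2) (A $ 1 $ 3) (A $ 2 $ 3)
      (x $ 1) (x $ 2) (x $ 3))"
proof -
  have h: "A $ i $ j = cnj (A $ j $ i)" for i j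
    using assms[unfolded hermitian_iff, rule_format, of j i] by (rule sym)
  have diag: "of_real (Re (A $ i $ i)) = A $ i $ i" for i
  proof (rule of_real_Re)
    show "A $ i $ i \<in> \<real>"
      using h[of i i, symmetric] by (rule iffD2[OF Reals_cnj_iff])
  qed
  have "(A *v x) $ i = A $ i $ 1 * x $ 1 + A $ i $ 2 * x $ 2 + A $ i $ 3 * x $ 3" for i
    by (simp add: matrix_vector_mult_def sum_3)
  then have "(\<Sum>i\<in>UNIV. cnj (x $ i) * (A *v x) $ i) =
      cnj (x $ 1) * (A $ 1 $ 1 * x $ 1 + A $ 1 $ 2 * x $ 2 + A $ 1 $ 3 * x $ 3)
    + cnj (x $ 2) * (cnj (A $ 1 $ 2) * x $ 1 + A $ 2 $ 2 * x $ 2 + A $ 2 $ 3 * x $ 3)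
    + cnj (x $ 3) * (cnj (A $ 1 $ 3) * x $ 1 + cnj (A $ 2 $ 3) * x $ 2 + A $ 3 $ 3 * x $ 3)"
    by (simp only: sum_3 h[of 2 1] h[of 3 1] h[of 3 2])
  then show ?thesis
    unfolding ternary_form_sesquilinear diag .
qed

lemma psd_matrices_3_iff:
  fixes A :: "complex ^ 3 ^ 3"
  shows "A \<in> psd_matrices \<longleftrightarrow> hermitian A \<and>
    minors_nonneg (Re (A $ 1 $ 1)) (Re (A $ 2 $ 2)) (Re (A $ 3 $ 3)) (A $ 1 $ 2) (A $ 1 $ 3) (A $ 2 $ 3)"
proof (cases "hermitian A")
  case True
  define P where "P = (\<lambda>x y z. 0 \<le> ternary_form (Re (A $ 1 $ 1)) (Re (A $ 2 $ 2)) (Re (A $ 3 $ 3))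
    (A $ 1 $ 2) (A $ 1 $ 3) (A $ 2 $ 3) x y z)"
  have "(\<forall>x :: complex ^ 3. P (x $ 1) (x $ 2) (x $ 3)) \<longleftrightarrow> (\<forall>x y z. P x y z)"
  proof (intro iffI allI)
    fix x y z
    assume *: "\<forall>x :: complex ^ 3. P (x $ 1) (x $ 2) (x $ 3)"
    show "P x y z"
      using *[rule_format, of "vector [x, y, z]"] by simp
  qed blast
  then show ?thesis
    using True unfolding psd_matrices_def mem_Collect_eq hermitian_form_3[OF True]
      nonneg_Reals_of_real_iff P_def ternary_form_nonneg_iff by blast
qed (simp add: psd_matrices_def)

section \<open>Entrywise products and powers of correlation matrices\<close>

text \<open>
  The determinant condition in Schur complement form bounds a single modulus, so that the triangle
  inequality becomes available.
\<close>

lemma correlation_iff: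
  "minors_nonneg 1 1 1 a b c \<longleftrightarrow> cmod a \<le> 1 \<and> cmod b \<le> 1 \<and> cmod c \<le> 1 \<and>
    (cmod (a - b * cnj c))\<^sup>2 \<le> (1 - (cmod b)\<^sup>2) * (1 - (cmod c)\<^sup>2)"
  using schur_complement_det[of 1 1 1 a b c]
  by (auto simp: minors_nonneg_def abs_square_le_1 algebra_simps)

text \<open>
  The Schur product theorem for correlation matrices. The off-diagonal entry of the Schur complement
  of the product splits as \<open>a' (a - b (cnj c)) + b (cnj c) (a' - b' (cnj c'))\<close>. Each summand is bounded by the
  Schur complement of one factor, and the Cauchy--Schwarz inequality in the plane adds the two bounds.
\<close>

lemma correlation_schur_product:
  assumes 1: "minors_nonneg 1 1 1 a b c" and 2: "minors_nonneg 1 1 1 a' b' c'"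
  shows "minors_nonneg 1 1 1 (a * a') (b * b') (c * c')"
proof -
  define s t s' t' where "s = sqrt (1 - (cmod b)\<^sup>2)" "t = sqrt (1 - (cmod c)\<^sup>2)"
    "s' = sqrt (1 - (cmod b')\<^sup>2)" "t' = sqrt (1 - (cmod c')\<^sup>2)"
  have le1: "cmod a \<le> 1" "cmod b \<le> 1" "cmod c \<le> 1" "cmod a' \<le> 1" "cmod b' \<le> 1" "cmod c' \<le> 1"
    using 1 2 by (simp_all add: correlation_iff)
  have sq: "s\<^sup>2 = 1 - (cmod b)\<^sup>2" "t\<^sup>2 = 1 - (cmod c)\<^sup>2" "s'\<^sup>2 = 1 - (cmod b')\<^sup>2" "t'\<^sup>2 = 1 - (cmod c')\<^sup>2"
    and nonneg: "0 \<le> s" "0 \<le> t" "0 \<le> s'" "0 \<le> t'"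
    using le1 by (simp_all add: s_t_s'_t'_def power_le_one)
  have "(cmod (a - b * cnj c))\<^sup>2 \<le> (s * t)\<^sup>2" "(cmod (a' - b' * cnj c'))\<^sup>2 \<le> (s' * t')\<^sup>2"
    using 1 2 by (simp_all only: correlation_iff power_mult_distrib sq)
  then have e: "cmod (a - b * cnj c) \<le> s * t" "cmod (a' - b' * cnj c') \<le> s' * t'"
    using nonneg by (auto intro: power2_le_imp_le)
  have "a * a' - b * b' * cnj (c * c') = a' * (a - b * cnj c) + (b * cnj c) * (a' - b' * cnj c')"
    by (simp add: algebra_simps)
  then have "cmod (a * a' - b * b' * cnj (c * c'))
      \<le> cmod a' * cmod (a - b * cnj c) + cmod b * cmod c * cmod (a' - b' * cnj c')"
    by (metis complex_mod_cnj norm_mult norm_triangle_ineq)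
  also have "\<dots> \<le> 1 * (s * t) + cmod b * cmod c * (s' * t')"
    using le1 e nonneg by (intro add_mono mult_mono) auto
  also have "\<dots> = s * t + (cmod b * s') * (cmod c * t')"
    by simp
  finally have "(cmod (a * a' - b * b' * cnj (c * c')))\<^sup>2 \<le> (s * t + (cmod b * s') * (cmod c * t'))\<^sup>2"
    by (intro power_mono) auto
  also have "\<dots> \<le> (s\<^sup>2 + (cmod b * s')\<^sup>2) * (t\<^sup>2 + (cmod c * t')\<^sup>2)"
    using sum_squares_ge_zero[of "s * (cmod c * t') - t * (cmod b * s')" 0]
    by (simp add: algebra_simps power2_eq_square)
  also have "\<dots> = (1 - (cmod (b * b'))\<^sup>2) * (1 - (cmod (c * c'))\<^sup>2)"
    by (simp add: power_mult_distrib sq norm_mult algebra_simps)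
  finally show ?thesis
    using le1 by (auto simp: correlation_iff norm_mult intro!: mult_le_one)
qed

text \<open>
  Here \<open>\<gamma>\<close> plays the role of the cosine of the argument of \<open>a (cnj b) c\<close>. The entrywise map may
  change this argument as long as the cosine does not decrease; the maps with \<open>\<beta> = 0\<close> and \<open>\<beta> = 1\<close> both fit.
\<close>

lemma correlation_power:
  assumes corr: "minors_nonneg 1 1 1 a b c" and \<alpha>: "1 \<le> \<alpha>" and \<gamma>: "\<gamma> \<le> 1"
    and triple: "Re (a * cnj b * c) \<le> cmod a * cmod b * cmod c * \<gamma>"
    and a': "cmod a' = cmod a powr \<alpha>" and b': "cmod b' = cmod b powr \<alpha>" and c': "cmod c' = cmod c powr \<alpha>"
    and triple': "Re (a' * cnj b' * c') = cmod a' * cmod b' * cmod c' * \<gamma>"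
  shows "minors_nonneg 1 1 1 a' b' c'"
proof -
  have le1: "cmod a \<le> 1" "cmod b \<le> 1" "cmod c \<le> 1"
    using corr by (simp_all add: correlation_iff)
  have "(cmod a)\<^sup>2 + (cmod b)\<^sup>2 + (cmod c)\<^sup>2 \<le> 1 + 2 * (cmod a * cmod b * cmod c * \<gamma>)"
    using corr triple by (simp add: minors_nonneg_def)
  then have "(cmod a')\<^sup>2 + (cmod b')\<^sup>2 + (cmod c')\<^sup>2 \<le> 1 + 2 * Re (a' * cnj b' * c')"
    unfolding triple' a' b' c'
    using le1 \<alpha> \<gamma> by (intro powers_preserve_cubic_inequality) auto
  moreover have "cmod a' \<le> 1" "cmod b' \<le> 1" "cmod c' \<le> 1"
    using le1 \<alpha> by (auto simp: a' b' c' intro!: powr_le1)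
  ultimately show ?thesis
    by (auto simp: minors_nonneg_def power_le_one)
qed

section \<open>Algebraic properties of the power functions\<close>

lemma cmod_Psi [simp]: "cmod (Psi \<alpha> \<beta> z) = cmod z powr \<alpha>"
  by (simp add: Psi_def)

lemma Psi_of_real_nonneg: "0 \<le> r \<Longrightarrow> Psi \<alpha> \<beta> (of_real r) = of_real (r powr \<alpha>)"
  by (simp add: Psi_def Arg_real)

lemma Psi_add: "Psi (\<alpha> + \<alpha>') (\<beta> + \<beta>') z = Psi \<alpha> \<beta> z * Psi \<alpha>' \<beta>' z"
  by (simp add: Psi_def rcis_mult powr_add algebra_simps)

lemma Psi_1_1: "Psi 1 1 z = z"
  by (simp add: Psi_def rcis_cmod_Arg)

lemma Psi_angle_0: "Psi \<alpha> 0 z = of_real (cmod z powr \<alpha>)"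
  by (simp add: Psi_def)

lemma Psi_uminus: "Psi \<alpha> (- \<beta>) z = cnj (Psi \<alpha> \<beta> z)"
  by (simp add: Psi_def rcis_def cis_cnj)

lemma Psi_scale: "0 < r \<Longrightarrow> Psi \<alpha> \<beta> (of_real r * z) = of_real (r powr \<alpha>) * Psi \<alpha> \<beta> z"
  by (simp add: Psi_def norm_mult powr_mult rcis_def)

text \<open>
  Integrality of \<open>\<beta>\<close> matters only on the negative real axis: it is fixed by conjugation, but
  the argument \<open>\<pi>\<close> is not negated there.
\<close>

lemma Psi_cnj:
  assumes "\<beta> \<in> \<int>"
  shows "Psi \<alpha> \<beta> (cnj z) = cnj (Psi \<alpha> \<beta> z)"
proof (cases "z \<in> \<real> \<and> Re z < 0")
  case True
  then have "Arg z = pi" "z \<in> \<real>"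
    by (auto simp: Arg_real)
  moreover have "sin (\<beta> * pi) = 0"
    using assms by (simp add: sin_times_pi_eq_0)
  ultimately show ?thesis
    by (simp add: Psi_def Arg_cnj complex_eq_iff)
next
  case False
  then have "Arg (cnj z) = - Arg z"
    by (auto simp: Arg_cnj Arg_real)
  then show ?thesis
    by (simp add: Psi_def complex_eq_iff)
qed

lemma minors_nonneg_cnj:
  "minors_nonneg k l m (cnj a) (cnj b) (cnj c) \<longleftrightarrow> minors_nonneg k l m a b c"
  by (simp add: minors_nonneg_def algebra_simps)

section \<open>Sufficiency\<close>

text \<open>
  Taking moduli replaces the cosine by \<open>1\<close>.
\<close>

lemma correlation_Psi_0:
  assumes corr: "minors_nonneg 1 1 1 a b c" and \<alpha>: "1 \<le> \<alpha>"
  shows "minors_nonneg 1 1 1 (Psi \<alpha> 0 a) (Psi \<alpha> 0 b) (Psi \<alpha> 0 c)"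
proof (rule correlation_power[OF corr \<alpha>, of 1])
  show "Re (a * cnj b * c) \<le> cmod a * cmod b * cmod c * 1"
    using complex_Re_le_cmod[of "a * cnj b * c"] by (simp add: norm_mult)
qed (simp_all add: Psi_angle_0)

lemma correlation_Psi_1:
  assumes corr: "minors_nonneg 1 1 1 a b c" and \<alpha>: "1 \<le> \<alpha>"
  shows "minors_nonneg 1 1 1 (Psi \<alpha> 1 a) (Psi \<alpha> 1 b) (Psi \<alpha> 1 c)"
proof -
  \<comment> \<open>If an entry is zero, the quotient is \<open>0\<close>, and \<open>triple\<close> still holds because its left side vanishes.\<close>
  define \<gamma> where "\<gamma> = Re (a * cnj b * c) / (cmod a * cmod b * cmod c)"
  have triple: "Re (a * cnj b * c) = cmod a * cmod b * cmod c * \<gamma>"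
    by (auto simp: \<gamma>_def)
  have "Re (a * cnj b * c) \<le> cmod a * cmod b * cmod c"
    using complex_Re_le_cmod[of "a * cnj b * c"] by (simp add: norm_mult)
  then have "\<gamma> \<le> cmod a * cmod b * cmod c / (cmod a * cmod b * cmod c)"
    unfolding \<gamma>_def by (intro divide_right_mono) auto
  also have "\<dots> \<le> 1"
    by (simp add: divide_self_if)
  finally have \<gamma>: "\<gamma> \<le> 1" .
  have Psi: "Psi \<alpha> 1 z = of_real (cmod z powr (\<alpha> - 1)) * z" for z
    using Psi_add[of "\<alpha> - 1" 1 0 1 z] by (simp add: Psi_angle_0 Psi_1_1)
  have powr: "cmod z powr \<alpha> = cmod z powr (\<alpha> - 1) * cmod z" for z :: complex
    using powr_mult_base[of "cmod z" "\<alpha> - 1"] by (simp add: mult.commute)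
  have "Re (Psi \<alpha> 1 a * cnj (Psi \<alpha> 1 b) * Psi \<alpha> 1 c)
      = cmod a powr (\<alpha> - 1) * cmod b powr (\<alpha> - 1) * cmod c powr (\<alpha> - 1) * Re (a * cnj b * c)"
    by (simp add: Psi algebra_simps)
  also have "\<dots> = cmod (Psi \<alpha> 1 a) * cmod (Psi \<alpha> 1 b) * cmod (Psi \<alpha> 1 c) * \<gamma>"
    unfolding triple cmod_Psi powr by simp
  finally show ?thesis
    using \<gamma> triple by (intro correlation_power[OF corr \<alpha>, of \<gamma>]) simp_all
qed

text \<open>
  Each factor \<open>z\<close> that is split off lowers the exponent and the angle factor by one, which keeps the
  condition \<open>n \<le> \<alpha>\<close>. The recursion stops at \<open>n = 1\<close>: splitting off another factor would leave the
  exponent \<open>\<alpha> - 1\<close>, which may be below \<open>1\<close>.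
\<close>

lemma correlation_Psi_nat:
  assumes corr: "minors_nonneg 1 1 1 a b c" and \<alpha>: "max 1 (real n) \<le> \<alpha>"
  shows "minors_nonneg 1 1 1 (Psi \<alpha> (real n) a) (Psi \<alpha> (real n) b) (Psi \<alpha> (real n) c)"
  using \<alpha>
proof (induction n arbitrary: \<alpha> rule: induct_nat_012)
  case 0
  then show ?case using correlation_Psi_0[OF corr] by simp
next
  case 1
  then show ?case using correlation_Psi_1[OF corr] by simp
next
  case (ge2 n)
  have "Psi \<alpha> (real (Suc (Suc n))) z = z * Psi (\<alpha> - 1) (real (Suc n)) z" for z
    using Psi_add[of 1 "\<alpha> - 1" 1 "real (Suc n)" z] by (simp add: Psi_1_1)
  then show ?case
    using correlation_schur_product[OF corr ge2.IH(2)[of "\<alpha> - 1"]] ge2.prems by simp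
qed

lemma correlation_Psi:
  assumes corr: "minors_nonneg 1 1 1 a b c" and \<beta>: "\<beta> \<in> \<int>" and \<alpha>: "max 1 \<bar>\<beta>\<bar> \<le> \<alpha>"
  shows "minors_nonneg 1 1 1 (Psi \<alpha> \<beta> a) (Psi \<alpha> \<beta> b) (Psi \<alpha> \<beta> c)"
proof -
  obtain i where "\<beta> = of_int i"
    using \<beta> by (rule Ints_cases)
  then obtain n where n: "\<bar>\<beta>\<bar> = real n"
    using of_nat_nat[of "\<bar>i\<bar>"] by (metis abs_ge_zero of_int_abs of_int_of_nat_eq)
  have "minors_nonneg 1 1 1 (Psi \<alpha> \<bar>\<beta>\<bar> a) (Psi \<alpha> \<bar>\<beta>\<bar> b) (Psi \<alpha> \<bar>\<beta>\<bar> c)"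
    using correlation_Psi_nat[OF corr, of n] \<alpha> n by simp
  then show ?thesis
    by (cases "0 \<le> \<beta>") (simp_all add: Psi_uminus minors_nonneg_cnj)
qed

text \<open>
  Congruence with a real diagonal matrix.
\<close>

lemma minors_nonneg_scale:
  assumes "minors_nonneg k l m a b c"
  shows "minors_nonneg (s\<^sup>2 * k) (t\<^sup>2 * l) (u\<^sup>2 * m)
    (of_real (s * t) * a) (of_real (s * u) * b) (of_real (t * u) * c)"
proof -
  have "s\<^sup>2 * t\<^sup>2 * (cmod a)\<^sup>2 \<le> s\<^sup>2 * t\<^sup>2 * (k * l)" "s\<^sup>2 * u\<^sup>2 * (cmod b)\<^sup>2 \<le> s\<^sup>2 * u\<^sup>2 * (k * m)"
    "t\<^sup>2 * u\<^sup>2 * (cmod c)\<^sup>2 \<le> t\<^sup>2 * u\<^sup>2 * (l * m)"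
    "s\<^sup>2 * t\<^sup>2 * u\<^sup>2 * (k * (cmod c)\<^sup>2 + l * (cmod b)\<^sup>2 + m * (cmod a)\<^sup>2)
      \<le> s\<^sup>2 * t\<^sup>2 * u\<^sup>2 * (k * l * m + 2 * Re (a * cnj b * c))"
    using assms by (auto simp: minors_nonneg_def intro!: mult_left_mono)
  moreover have "Re (of_real (s * t) * a * cnj (of_real (s * u) * b) * (of_real (t * u) * c))
      = s\<^sup>2 * t\<^sup>2 * u\<^sup>2 * Re (a * cnj b * c)"
  proof -
    have "of_real (s * t) * a * cnj (of_real (s * u) * b) * (of_real (t * u) * c)
        = of_real (s\<^sup>2 * t\<^sup>2 * u\<^sup>2) * (a * cnj b * c)"
      by (simp add: power2_eq_square)
    moreover have "Re (of_real r * z) = r * Re z" for r z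
      by simp
    ultimately show ?thesis
      by (simp only:)
  qed
  moreover have "(cmod (of_real x * z))\<^sup>2 = x\<^sup>2 * (cmod z)\<^sup>2" for x z
    by (simp add: norm_mult power_mult_distrib)
  moreover have "0 \<le> s\<^sup>2 * k" "0 \<le> t\<^sup>2 * l" "0 \<le> u\<^sup>2 * m"
    using assms by (simp_all add: minors_nonneg_def)
  ultimately show ?thesis
    unfolding minors_nonneg_def by (simp only: power_mult_distrib algebra_simps)
qed

text \<open>
  The diagonal is scaled to \<open>1\<close> before \<open>Psi\<close> is applied, and back afterwards by the \<open>\<alpha>\<close>-th powers
  of the same factors. This requires a nonzero diagonal; otherwise the conditions on the \<open>2 \<times> 2\<close>
  minors, which \<open>Psi\<close> respects by monotonicity, are all that is left.
\<close>

lemma minors_nonneg_Psi: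
  assumes min: "minors_nonneg k l m a b c" and \<beta>: "\<beta> \<in> \<int>" and \<alpha>: "max 1 \<bar>\<beta>\<bar> \<le> \<alpha>"
  shows "minors_nonneg (k powr \<alpha>) (l powr \<alpha>) (m powr \<alpha>) (Psi \<alpha> \<beta> a) (Psi \<alpha> \<beta> b) (Psi \<alpha> \<beta> c)"
proof (cases "k = 0 \<or> l = 0 \<or> m = 0")
  case True
  have "(cmod (Psi \<alpha> \<beta> z))\<^sup>2 \<le> r powr \<alpha> * s powr \<alpha>" if "(cmod z)\<^sup>2 \<le> r * s" "0 \<le> r" "0 \<le> s" for z r s
  proof -
    have "(cmod (Psi \<alpha> \<beta> z))\<^sup>2 = (cmod z)\<^sup>2 powr \<alpha>"
      by (simp add: power2_eq_square powr_mult)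
    also have "\<dots> \<le> (r * s) powr \<alpha>"
      using that(1) \<alpha> by (intro powr_mono2) auto
    finally show ?thesis using that by (simp add: powr_mult)
  qed
  then show ?thesis
    using min True unfolding minors_nonneg_def
    by (intro conjI det_nonneg_of_zero_diagonal) auto
next
  case False
  then have pos: "0 < k" "0 < l" "0 < m"
    using min by (auto simp: minors_nonneg_def)
  define s t u where "s = sqrt k" "t = sqrt l" "u = sqrt m"
  have stu: "0 < s" "0 < t" "0 < u" "s\<^sup>2 = k" "t\<^sup>2 = l" "u\<^sup>2 = m"
    using pos by (simp_all add: s_t_u_def)
  define a' b' c' where "a' = of_real (1 / s * (1 / t)) * a" "b' = of_real (1 / s * (1 / u)) * b"
    "c' = of_real (1 / t * (1 / u)) * c"
  have orig: "a = of_real (s * t) * a'" "b = of_real (s * u) * b'" "c = of_real (t * u) * c'"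
    using stu by (simp_all add: a'_b'_c'_def)
  have "minors_nonneg 1 1 1 a' b' c'"
    using minors_nonneg_scale[OF min, of "1 / s" "1 / t" "1 / u"] stu pos
    by (simp add: a'_b'_c'_def power_divide)
  then have "minors_nonneg 1 1 1 (Psi \<alpha> \<beta> a') (Psi \<alpha> \<beta> b') (Psi \<alpha> \<beta> c')"
    using \<beta> \<alpha> by (rule correlation_Psi)
  from minors_nonneg_scale[OF this, of "s powr \<alpha>" "t powr \<alpha>" "u powr \<alpha>"]
  have "minors_nonneg (k powr \<alpha>) (l powr \<alpha>) (m powr \<alpha>)
      (of_real (s powr \<alpha> * t powr \<alpha>) * Psi \<alpha> \<beta> a') (of_real (s powr \<alpha> * u powr \<alpha>) * Psi \<alpha> \<beta> b')
      (of_real (t powr \<alpha> * u powr \<alpha>) * Psi \<alpha> \<beta> c')"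
    unfolding stu(4-6)[symmetric] by (simp add: power2_eq_square powr_mult)
  moreover have "Psi \<alpha> \<beta> a = of_real (s powr \<alpha> * t powr \<alpha>) * Psi \<alpha> \<beta> a'"
    "Psi \<alpha> \<beta> b = of_real (s powr \<alpha> * u powr \<alpha>) * Psi \<alpha> \<beta> b'"
    "Psi \<alpha> \<beta> c = of_real (t powr \<alpha> * u powr \<alpha>) * Psi \<alpha> \<beta> c'"
    unfolding orig using stu by (simp_all only: Psi_scale mult_pos_pos powr_mult less_imp_le)
  ultimately show ?thesis
    by (simp only:)
qed

lemma preserves_positivity_sufficient:
  assumes \<beta>: "\<beta> \<in> \<int>" and \<alpha>: "max 1 \<bar>\<beta>\<bar> \<le> \<alpha>"
  shows "preserves_positivity_on (Psi \<alpha> \<beta>) (psd_matrices :: (complex ^ 3 ^ 3) set)"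
  unfolding preserves_positivity_on_def
proof
  fix A :: "complex ^ 3 ^ 3"
  assume A: "A \<in> psd_matrices"
  then have herm: "cnj (A $ j $ i) = A $ i $ j" for i j
    by (simp add: psd_matrices_3_iff hermitian_iff)
  have min: "minors_nonneg (Re (A $ 1 $ 1)) (Re (A $ 2 $ 2)) (Re (A $ 3 $ 3)) (A $ 1 $ 2) (A $ 1 $ 3) (A $ 2 $ 3)"
    using A by (simp add: psd_matrices_3_iff)
  have "A $ i $ i = of_real (Re (A $ i $ i))" for i
    using herm[of i i] by (metis Reals_cnj_iff of_real_Re)
  then have diag: "Re (Psi \<alpha> \<beta> (A $ i $ i)) = Re (A $ i $ i) powr \<alpha>" if "0 \<le> Re (A $ i $ i)" for i
    using that Psi_of_real_nonneg by (metis Re_complex_of_real)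
  have "hermitian (map_matrix (Psi \<alpha> \<beta>) A)"
    using \<beta> by (simp add: hermitian_iff map_matrix_def herm flip: Psi_cnj)
  moreover have "0 \<le> Re (A $ 1 $ 1)" "0 \<le> Re (A $ 2 $ 2)" "0 \<le> Re (A $ 3 $ 3)"
    using min by (simp_all add: minors_nonneg_def)
  ultimately show "map_matrix (Psi \<alpha> \<beta>) A \<in> psd_matrices"
    using minors_nonneg_Psi[OF min \<beta> \<alpha>] by (simp add: psd_matrices_3_iff map_matrix_def diag)
qed

section \<open>Necessity\<close>

lemma minors_nonneg_Psi_of_preserves:
  assumes pres: "preserves_positivity_on (Psi \<alpha> \<beta>) (psd_matrices :: (complex ^ 3 ^ 3) set)"
    and min: "minors_nonneg k l m a b c"
  shows "minors_nonneg (k powr \<alpha>) (l powr \<alpha>) (m powr \<alpha>) (Psi \<alpha> \<beta> a) (Psi \<alpha> \<beta> b) (Psi \<alpha> \<beta> c)"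
proof -
  define A :: "complex ^ 3 ^ 3" where
    "A = vector [vector [of_real k, a, b], vector [cnj a, of_real l, c], vector [cnj b, cnj c, of_real m]]"
  have "A \<in> psd_matrices"
    using min by (simp add: psd_matrices_3_iff hermitian_iff forall_3 A_def)
  then have "map_matrix (Psi \<alpha> \<beta>) A \<in> psd_matrices"
    using pres by (simp add: preserves_positivity_on_def)
  moreover have "0 \<le> k" "0 \<le> l" "0 \<le> m"
    using min by (simp_all add: minors_nonneg_def)
  ultimately show ?thesis
    by (simp add: psd_matrices_3_iff map_matrix_def A_def Psi_of_real_nonneg)
qed

text \<open>
  The vectors \<open>(1, 0), (0, 1), (1, 1)\<close> have the Gram matrix used here. Its determinant is \<open>0\<close>, and that of its
  image is \<open>2 powr \<alpha> - 2\<close>.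
\<close>

lemma exponent_ge_1_of_preserves:
  assumes pres: "preserves_positivity_on (Psi \<alpha> \<beta>) (psd_matrices :: (complex ^ 3 ^ 3) set)"
  shows "1 \<le> \<alpha>"
proof -
  have "minors_nonneg 1 1 2 0 1 1"
    by (simp add: minors_nonneg_def)
  from minors_nonneg_Psi_of_preserves[OF pres this]
  have "2 \<le> 2 powr \<alpha>"
    using Psi_of_real_nonneg[of 1 \<alpha> \<beta>] by (simp add: minors_nonneg_def Psi_def)
  then have "(2::real) powr 1 \<le> 2 powr \<alpha>"
    by simp
  then show ?thesis
    by (subst (asm) powr_le_cancel_iff) auto
qed

text \<open>
  Three principal arguments that each equal \<open>2 \<pi> / 3\<close> add up to a full turn, which is invisible in
  the matrix. Multiplying each of them by \<open>\<beta>\<close> gives the total \<open>2 \<pi> \<beta>\<close>, and a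
  correlation matrix with unimodular entries admits only multiples of \<open>2 \<pi>\<close> as this total.
\<close>

lemma angle_factor_Ints_of_preserves:
  assumes pres: "preserves_positivity_on (Psi \<alpha> \<beta>) (psd_matrices :: (complex ^ 3 ^ 3) set)"
  shows "\<beta> \<in> \<int>"
proof -
  define \<theta> where "\<theta> = 2 * pi / 3"
  have Psi_cis: "Psi \<alpha> \<beta> (cis t) = cis (\<beta> * t)" if "t \<in> {- pi<..pi}" for t
    using that by (simp add: Psi_def Arg_cis rcis_def)
  have "0 < \<theta>" "\<theta> < pi"
    using pi_gt_zero by (simp_all add: \<theta>_def)
  then have \<theta>: "\<theta> \<in> {- pi<..pi}" "- \<theta> \<in> {- pi<..pi}"
    by simp_all
  have winding: "cis x * cnj (cis (- x)) * cis x = cis (3 * x)" for x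
    by (simp add: cis_cnj cis_mult)
  have "cis (3 * \<theta>) = 1"
    by (simp add: \<theta>_def)
  then have "minors_nonneg 1 1 1 (cis \<theta>) (cis (- \<theta>)) (cis \<theta>)"
    unfolding minors_nonneg_def winding by simp
  from minors_nonneg_Psi_of_preserves[OF pres this]
  have "minors_nonneg 1 1 1 (cis (\<beta> * \<theta>)) (cis (- (\<beta> * \<theta>))) (cis (\<beta> * \<theta>))"
    using \<theta> by (simp add: Psi_cis)
  then have "1 \<le> cos (3 * (\<beta> * \<theta>))"
    unfolding minors_nonneg_def winding by simp
  then have "cos (3 * (\<beta> * \<theta>)) = 1"
    using cos_le_one[of "3 * (\<beta> * \<theta>)"] by linarith
  then obtain n :: int where "3 * (\<beta> * \<theta>) = of_int n * 2 * pi"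
    by (auto simp: cos_one_2pi_int)
  then have "\<beta> = of_int n"
    by (simp add: \<theta>_def)
  then show ?thesis by simp
qed

lemma Re_Im_one_add_cis_120:
  "Re (1 + of_real s * cis (2 * pi / 3)) = 1 - s / 2"
  "Im (1 + of_real s * cis (2 * pi / 3)) = sqrt 3 / 2 * s"
  by (simp_all add: cos_120 sin_120)

lemma cmod_one_add_cis_120:
  "(cmod (1 + of_real s * cis (2 * pi / 3)))\<^sup>2 = 1 - s + s\<^sup>2"
  unfolding cmod_power2 Re_Im_one_add_cis_120
  by (simp add: power_mult_distrib power_divide) (simp add: power2_eq_square field_simps)

lemma Arg_one_add_cis_120:
  assumes "s < 2"
  shows "Arg (1 + of_real s * cis (2 * pi / 3)) = arctan (sqrt 3 * s / (2 - s))"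
proof -
  let ?z = "1 + of_real s * cis (2 * pi / 3)"
  have "0 < Re ?z"
    unfolding Re_Im_one_add_cis_120 using assms by simp
  then have "Arg ?z = arctan (Im ?z / Re ?z)"
    by (rule arg_conv_arctan)
  also have "Im ?z / Re ?z = sqrt 3 * s / (2 - s)"
    unfolding Re_Im_one_add_cis_120 using assms by (simp add: field_simps)
  finally show ?thesis .
qed

text \<open>
  This matrix is the sum of the all-ones matrix and of \<open>s w w\<^sup>*\<close>, where the entries of \<open>w\<close> are the three cube roots of
  unity. In particular its determinant is \<open>0\<close>.
\<close>

lemma circulant_minors_nonneg:
  assumes "0 \<le> s"
  defines "a \<equiv> 1 + of_real s * cis (2 * pi / 3)"
  shows "minors_nonneg (1 + s) (1 + s) (1 + s) a (cnj a) a"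
proof -
  have a: "Re a = 1 - s / 2" "Im a = sqrt 3 / 2 * s"
    unfolding a_def by (rule Re_Im_one_add_cis_120)+
  have norm: "(cmod a)\<^sup>2 = 1 - s + s\<^sup>2"
    unfolding a_def by (rule cmod_one_add_cis_120)
  have Im2: "(Im a)\<^sup>2 = 3 / 4 * s\<^sup>2"
    unfolding a by (simp add: power_mult_distrib power_divide)
  have "Re (a * a * a) = (Re a)^3 - 3 * Re a * (Im a)\<^sup>2"
    by (simp add: power2_eq_square power3_eq_cube algebra_simps)
  also have "\<dots> = 1 - 3 / 2 * s - 3 / 2 * s\<^sup>2 + s ^ 3"
    unfolding Im2 a(1) by (simp add: power2_eq_square power3_eq_cube field_simps)
  finally have det: "2 * Re (a * a * a) = 2 - 3 * s - 3 * s\<^sup>2 + 2 * s ^ 3"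
    by simp
  have "(1 + s) * (1 + s) = 1 + 2 * s + s\<^sup>2"
    "(1 + s) * (1 - s + s\<^sup>2) = 1 + s ^ 3" "(1 + s) * (1 + s) * (1 + s) = 1 + 3 * s + 3 * s\<^sup>2 + s ^ 3"
    by (simp_all add: power2_eq_square power3_eq_cube algebra_simps)
  then show ?thesis
    using assms(1) unfolding minors_nonneg_def complex_cnj_cnj complex_mod_cnj norm det by linarith
qed

text \<open>
  The vectors that list the powers of a cube root of unity \<open>\<eta>\<close> are eigenvectors of every circulant
  matrix; here \<open>\<eta>\<^sup>2\<close> is written as \<open>cnj \<eta>\<close>. The factor \<open>3\<close> is the squared norm of the vector.
\<close>

lemma circulant_form:
  assumes "\<eta> ^ 3 = 1" "cmod \<eta> = 1"
  shows "ternary_form k k k a (cnj a) a 1 \<eta> (cnj \<eta>) = 3 * (k + 2 * Re (a * \<eta>))"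
proof -
  have "\<eta> * cnj \<eta> = 1"
    using assms(2) complex_norm_square[of \<eta>] by simp
  then have "cnj \<eta> * cnj \<eta> = \<eta>"
    using assms(1) by (metis (no_types) complex_cnj_mult complex_cnj_one mult.assoc mult.commute mult.right_neutral power3_eq_cube complex_cnj_cnj)
  then have "cnj \<eta> * a * cnj \<eta> = a * \<eta>"
    by (metis mult.assoc mult.commute)
  moreover have "Re (cnj a * cnj \<eta>) = Re (a * \<eta>)"
    by simp
  ultimately have "ternary_form k k k a (cnj a) a 1 \<eta> (cnj \<eta>)
      = k + k + k + 2 * (Re (a * \<eta>) + Re (a * \<eta>) + Re (a * \<eta>))"
    using assms(2)
    by (simp only: ternary_form_def complex_cnj_one complex_cnj_cnj complex_mod_cnj norm_one
        power_one mult_1_left mult_1_right plus_complex.sel)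
  moreover have "k + k + k + 2 * (r + r + r) = 3 * (k + 2 * r)" for r
    by simp
  ultimately show ?thesis
    by (simp only:)
qed

text \<open>
  The function \<open>F\<close> is the eigenvalue of the image of the circulant matrix that belongs to the primitive
  cube root of unity with argument \<open>\<sigma> 2 \<pi> / 3\<close>. It vanishes at \<open>s = 0\<close>, where the image is the all-ones matrix, and its
  derivative there is \<open>3 (\<alpha> - \<sigma> \<beta>) / 2\<close>. A negative derivative would make the eigenvalue negative for
  small \<open>s > 0\<close>.
\<close>

lemma exponent_ge_angle_factor_of_preserves:
  assumes pres: "preserves_positivity_on (Psi \<alpha> \<beta>) (psd_matrices :: (complex ^ 3 ^ 3) set)"
    and \<beta>: "\<beta> \<in> \<int>" and \<sigma>: "\<sigma> = 1 \<or> \<sigma> = - 1"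
  shows "\<sigma> * \<beta> \<le> \<alpha>"
proof (rule ccontr)
  assume "\<not> \<sigma> * \<beta> \<le> \<alpha>"
  \<comment> \<open>the argument of \<open>1 + s * cis (2 * pi / 3)\<close>\<close>
  define \<phi> where "\<phi> = (\<lambda>s::real. arctan (sqrt 3 * s / (2 - s)))"
  define F where "F = (\<lambda>s. (1 + s) powr \<alpha>
    + 2 * ((1 - s + s\<^sup>2) powr (\<alpha> / 2) * cos (\<beta> * \<phi> s + \<sigma> * (2 * pi / 3))))"
  have F_nonneg: "0 \<le> F s" if s: "0 < s" "s < 2" for s
  proof -
    define a where "a = 1 + of_real s * cis (2 * pi / 3)"
    define \<eta> where "\<eta> = cis (\<sigma> * (2 * pi / 3))"
    have "minors_nonneg ((1 + s) powr \<alpha>) ((1 + s) powr \<alpha>) ((1 + s) powr \<alpha>)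
      (Psi \<alpha> \<beta> a) (cnj (Psi \<alpha> \<beta> a)) (Psi \<alpha> \<beta> a)"
      using minors_nonneg_Psi_of_preserves[OF pres circulant_minors_nonneg[of s]] s
      unfolding a_def by (simp only: Psi_cnj[OF \<beta>])
    then have "0 \<le> ternary_form ((1 + s) powr \<alpha>) ((1 + s) powr \<alpha>) ((1 + s) powr \<alpha>)
      (Psi \<alpha> \<beta> a) (cnj (Psi \<alpha> \<beta> a)) (Psi \<alpha> \<beta> a) 1 \<eta> (cnj \<eta>)"
      unfolding ternary_form_nonneg_iff[symmetric] by blast
    moreover have "\<eta> ^ 3 = 1" "cmod \<eta> = 1"
      using \<sigma> by (auto simp: \<eta>_def Complex.DeMoivre complex_eq_iff)
    ultimately have "0 \<le> (1 + s) powr \<alpha> + 2 * Re (Psi \<alpha> \<beta> a * \<eta>)"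
      by (simp only: circulant_form) simp
    moreover have "Re (Psi \<alpha> \<beta> a * \<eta>) = (1 - s + s\<^sup>2) powr (\<alpha> / 2) * cos (\<beta> * \<phi> s + \<sigma> * (2 * pi / 3))"
    proof -
      have "0 < Re a"
        unfolding a_def Re_Im_one_add_cis_120 using s by simp
      then have "a \<noteq> 0" by auto
      have "cmod a powr \<alpha> = ((cmod a)\<^sup>2) powr (\<alpha> / 2)"
        using \<open>a \<noteq> 0\<close> by (simp add: powr_powr flip: powr_numeral)
      then have "Psi \<alpha> \<beta> a = rcis ((1 - s + s\<^sup>2) powr (\<alpha> / 2)) (\<beta> * \<phi> s)"
        using \<open>a \<noteq> 0\<close> s by (simp only: Psi_def if_False a_def cmod_one_add_cis_120 Arg_one_add_cis_120 \<phi>_def)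
      moreover have "\<eta> = rcis 1 (\<sigma> * (2 * pi / 3))"
        by (simp add: \<eta>_def rcis_def)
      ultimately show ?thesis
        by (simp only: rcis_mult Re_rcis mult_1_right)
    qed
    ultimately show ?thesis
      by (simp only: F_def)
  qed
  have F_0: "F 0 = 0"
    using \<sigma> by (auto simp: F_def \<phi>_def cos_120)
  have sin_\<sigma>: "cos (\<sigma> * (2 * pi / 3)) = - 1 / 2" "sin (\<sigma> * (2 * pi / 3)) = \<sigma> * sqrt 3 / 2"
    using \<sigma> by (auto simp: cos_120 sin_120)
  have "(F has_real_derivative (\<alpha> + 2 * (- \<alpha> / 2 * cos (\<sigma> * (2 * pi / 3))
      - sin (\<sigma> * (2 * pi / 3)) * (\<beta> * (sqrt 3 / 2))))) (at 0)"
    unfolding F_def \<phi>_def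
    by (rule derivative_eq_intros refl | simp)+
  moreover have "\<alpha> + 2 * (- \<alpha> / 2 * cos (\<sigma> * (2 * pi / 3)) - sin (\<sigma> * (2 * pi / 3)) * (\<beta> * (sqrt 3 / 2)))
      = 3 / 2 * (\<alpha> - \<sigma> * \<beta>)"
    unfolding sin_\<sigma> by (simp add: field_simps)
  ultimately have "(F has_real_derivative 3 / 2 * (\<alpha> - \<sigma> * \<beta>)) (at 0)"
    by (simp only:)
  then obtain d where d: "0 < d" "\<And>h. 0 < h \<Longrightarrow> h < d \<Longrightarrow> F (0 + h) < F 0"
    using DERIV_neg_dec_right[of F _ 0] \<open>\<not> \<sigma> * \<beta> \<le> \<alpha>\<close> by force
  have "F (min (d / 2) 1) < 0"
    using d(2)[of "min (d / 2) 1"] d(1) F_0 by (simp add: min_def split: if_splits)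
  then show False
    using F_nonneg[of "min (d / 2) 1"] d(1) by (simp add: min_def split: if_splits)
qed

theorem corollary3p2:
  fixes \<alpha> \<beta> :: real
  shows "preserves_positivity_on (Psi \<alpha> \<beta>) (psd_matrices :: (complex ^ 3 ^ 3) set)
    \<longleftrightarrow> \<beta> \<in> \<int> \<and> \<alpha> \<ge> max 1 \<bar>\<beta>\<bar>"
proof
  assume pres: "preserves_positivity_on (Psi \<alpha> \<beta>) (psd_matrices :: (complex ^ 3 ^ 3) set)"
  have \<beta>: "\<beta> \<in> \<int>"
    using pres by (rule angle_factor_Ints_of_preserves)
  moreover have "1 \<le> \<alpha>"
    using pres by (rule exponent_ge_1_of_preserves)
  moreover have "\<bar>\<beta>\<bar> \<le> \<alpha>"
    using exponent_ge_angle_factor_of_preserves[OF pres \<beta>, of 1]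
      exponent_ge_angle_factor_of_preserves[OF pres \<beta>, of "- 1"] by simp
  ultimately show "\<beta> \<in> \<int> \<and> \<alpha> \<ge> max 1 \<bar>\<beta>\<bar>"
    by simp
qed (simp add: preserves_positivity_sufficient)

end
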